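(* Let $T\in L(H^2)$. For every operator $X\in\{S_{L(H^2)}\}'$ such that $X(T)\in\{S\}'$, there is a function $\theta'\in H^\infty$ such that $X(S^{n}T)=M_{\theta'}(S^n)$ for every $n=0,1,2,\dots$.
   Context: $\mathbf{D}$ is the open unit disc in $\mathbb{C}$. $H^2$ is the Hardy space of analytic functions $f(z)=\sum_{n\ge 0}a_nz^n$ on $\mathbf{D}$ with $\sum_{n\ge 0}|a_n|^2<\infty$, a Hilbert space with inner product $(f,g)=\sum_n a_n\overline{b_n}$ for $f(z)=\sum a_nz^n$, $g(z)=\sum b_nz^n$. $L(H^2)$ is the Banach space of bounded linear operators on $H^2$ with the operator norm, and $L(L(H^2))$ is the space of bounded linear operators on the Banach space $L(H^2)$. $H^\infty$ is the Banach space of bounded analytic functions on $\mathbf{D}$ with the supremum norm. For $\theta\in H^\infty$, $T_\theta\in L(H^2)$ is given by $(T_\theta f)(z)=\theta(z)f(z)$, and $M_\theta:L(H^2)\to L(H^2)$ is defined by $M_\theta T=T_\theta T$. $S\in L(H^2)$ is the shift $(Sf)(z)=zf(z)$, with $S^0=I_{H^2}$ the identity operator, and $S_{L(H^2)}:L(H^2)\to L(H^2)$ is defined by $S_{L(H^2)}(T)=ST$. The commutants are $\{S\}'=\{T\in L(H^2):ST=TS\}$ and $\{S_{L(H^2)}\}'=\{X\in L(L(H^2)):S_{L(H^2)}X=XS_{L(H^2)}\}$. *)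

theory Defs
  imports "HOL-Complex_Analysis.Complex_Analysis"
begin

section \<open>Complex normed spaces and bounded complex-linear operators\<close>

class complex_normed_vector = real_normed_vector +
  fixes scaleC :: "complex \<Rightarrow> 'a \<Rightarrow> 'a" (infixr \<open>*\<^sub>C\<close> 75)
  assumes scaleC_add_right: "c *\<^sub>C (x + y) = c *\<^sub>C x + c *\<^sub>C y"
    and scaleC_add_left: "(c + d) *\<^sub>C x = c *\<^sub>C x + d *\<^sub>C x"
    and scaleC_scaleC: "c *\<^sub>C d *\<^sub>C x = (c * d) *\<^sub>C x"
    and scaleC_of_real: "of_real r *\<^sub>C x = r *\<^sub>R x"
    and norm_scaleC: "norm (c *\<^sub>C x) = cmod c * norm x"

lemma scaleC_bounded_linear: "bounded_linear (\<lambda>x :: 'a::complex_normed_vector. c *\<^sub>C x)"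
proof (rule bounded_linear_intro[where K = "cmod c"])
  show "c *\<^sub>C (x + y) = c *\<^sub>C x + c *\<^sub>C y" for x y :: 'a
    by (rule scaleC_add_right)
  show "c *\<^sub>C (r *\<^sub>R x) = r *\<^sub>R (c *\<^sub>C x)" for r and x :: 'a
    unfolding scaleC_of_real [symmetric] scaleC_scaleC by (simp only: mult.commute)
  show "norm (c *\<^sub>C x) \<le> norm x * cmod c" for x :: 'a
    by (simp only: norm_scaleC mult.commute order_refl)
qed

lemmas scaleC_linear_simps =
  bounded_linear.linear[OF scaleC_bounded_linear, THEN linear_0]
  bounded_linear.linear[OF scaleC_bounded_linear, THEN linear_diff]
  bounded_linear.linear[OF scaleC_bounded_linear, THEN linear_neg]
  bounded_linear.linear[OF scaleC_bounded_linear, THEN linear_cmul]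

text \<open>
  A real-linear map that commutes with complex scalars is complex-linear, so bounded complex-linear
  operators form a subtype of the library type of bounded real-linear operators; the operator norm
  is inherited.
\<close>

typedef (overloaded) ('a, 'b) cblinfun =
  "{A :: 'a::complex_normed_vector \<Rightarrow>\<^sub>L 'b::complex_normed_vector.
      \<forall>c x. blinfun_apply A (c *\<^sub>C x) = c *\<^sub>C blinfun_apply A x}"
  morphisms blinfun_of_cblinfun CBlinfun
  by (rule exI[of _ 0]) (simp add: scaleC_linear_simps)

setup_lifting type_definition_cblinfun

type_synonym 'a endo = "('a, 'a) cblinfun"

lift_definition cblinfun_apply ::
    "('a::complex_normed_vector, 'b::complex_normed_vector) cblinfun \<Rightarrow> 'a \<Rightarrow> 'b" (infixl \<open>\<cdot>\<close> 80)
  is blinfun_apply .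

lemma cblinfun_eqI: "(\<And>x. A \<cdot> x = B \<cdot> x) \<Longrightarrow> A = B"
  by transfer (rule blinfun_eqI)

lemma cblinfun_apply_scaleC: "A \<cdot> (c *\<^sub>C x) = c *\<^sub>C (A \<cdot> x)"
  by transfer simp

lift_definition cblinfun_compose ::
    "('b::complex_normed_vector, 'c::complex_normed_vector) cblinfun
      \<Rightarrow> ('a::complex_normed_vector, 'b) cblinfun \<Rightarrow> ('a, 'c) cblinfun" (infixl \<open>o\<^sub>C\<close> 70)
  is blinfun_compose by simp

lemma cblinfun_apply_compose: "(A o\<^sub>C B) \<cdot> x = A \<cdot> (B \<cdot> x)"
  by transfer simp

lift_definition cblinfun_id :: "'a::complex_normed_vector endo" is id_blinfun by simp

primrec cblinfun_power :: "'a::complex_normed_vector endo \<Rightarrow> nat \<Rightarrow> 'a endo" where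
  "cblinfun_power A 0 = cblinfun_id"
| "cblinfun_power A (Suc n) = A o\<^sub>C cblinfun_power A n"

definition commutant :: "'a::complex_normed_vector endo \<Rightarrow> 'a endo set" where
  "commutant A = {B. A o\<^sub>C B = B o\<^sub>C A}"

instantiation cblinfun :: (complex_normed_vector, complex_normed_vector) complex_normed_vector
begin

lift_definition zero_cblinfun :: "('a, 'b) cblinfun" is 0
  by (simp add: scaleC_linear_simps)

lift_definition plus_cblinfun :: "('a, 'b) cblinfun \<Rightarrow> ('a, 'b) cblinfun \<Rightarrow> ('a, 'b) cblinfun"
  is "(+)" by (simp add: blinfun.add_left scaleC_add_right)

lift_definition minus_cblinfun :: "('a, 'b) cblinfun \<Rightarrow> ('a, 'b) cblinfun \<Rightarrow> ('a, 'b) cblinfun"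
  is "(-)" by (simp add: blinfun.diff_left scaleC_linear_simps)

lift_definition uminus_cblinfun :: "('a, 'b) cblinfun \<Rightarrow> ('a, 'b) cblinfun"
  is uminus by (simp add: blinfun.minus_left scaleC_linear_simps)

lift_definition scaleR_cblinfun :: "real \<Rightarrow> ('a, 'b) cblinfun \<Rightarrow> ('a, 'b) cblinfun"
  is "(*\<^sub>R)" by (simp add: blinfun.scaleR_left scaleC_linear_simps)

lemma bounded_linear_scaleC_blinfun: "bounded_linear (\<lambda>x. c *\<^sub>C blinfun_apply A x)"
  by (rule bounded_linear_compose[OF scaleC_bounded_linear blinfun.bounded_linear_right])

lift_definition scaleC_cblinfun :: "complex \<Rightarrow> ('a, 'b) cblinfun \<Rightarrow> ('a, 'b) cblinfun"
  is "\<lambda>c A. Blinfun (\<lambda>x. c *\<^sub>C blinfun_apply A x)"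
  by (simp add: bounded_linear_Blinfun_apply bounded_linear_scaleC_blinfun
      scaleC_scaleC mult.commute)

lemma cblinfun_apply_ops:
  "(A + B) \<cdot> x = A \<cdot> x + B \<cdot> x"
  "(r *\<^sub>R A) \<cdot> x = r *\<^sub>R (A \<cdot> x)"
  "(c *\<^sub>C A) \<cdot> x = c *\<^sub>C (A \<cdot> x)"
  "A \<cdot> (x + y) = A \<cdot> x + A \<cdot> y"
  "A \<cdot> (r *\<^sub>R x) = r *\<^sub>R (A \<cdot> x)"
  by (simp_all add: cblinfun_apply.rep_eq plus_cblinfun.rep_eq scaleR_cblinfun.rep_eq
      scaleC_cblinfun.rep_eq blinfun.add_left blinfun.scaleR_left blinfun.add_right
      blinfun.scaleR_right bounded_linear_Blinfun_apply bounded_linear_scaleC_blinfun)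

lift_definition norm_cblinfun :: "('a, 'b) cblinfun \<Rightarrow> real" is norm .

definition dist_cblinfun :: "('a, 'b) cblinfun \<Rightarrow> ('a, 'b) cblinfun \<Rightarrow> real" where
  "dist_cblinfun A B = norm (A - B)"

definition sgn_cblinfun :: "('a, 'b) cblinfun \<Rightarrow> ('a, 'b) cblinfun" where
  "sgn_cblinfun A = scaleR (inverse (norm A)) A"

definition uniformity_cblinfun :: "(('a, 'b) cblinfun \<times> ('a, 'b) cblinfun) filter" where
  "uniformity_cblinfun = (INF e\<in>{0<..}. principal {(A, B). dist A B < e})"

definition open_cblinfun :: "('a, 'b) cblinfun set \<Rightarrow> bool" where
  "open_cblinfun U = (\<forall>A\<in>U. \<forall>\<^sub>F (A', B) in uniformity. A' = A \<longrightarrow> B \<in> U)"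

instance
proof
  fix A B C :: "('a, 'b) cblinfun" and r s :: real and c d :: complex
  show "A + B + C = A + (B + C)" "A + B = B + A" "0 + A = A" "- A + A = 0" "A - B = A + - B"
    by (transfer, simp)+
  show "r *\<^sub>R (A + B) = r *\<^sub>R A + r *\<^sub>R B" "(r + s) *\<^sub>R A = r *\<^sub>R A + s *\<^sub>R A"
    "r *\<^sub>R s *\<^sub>R A = (r * s) *\<^sub>R A" "1 *\<^sub>R A = A"
    by (transfer, simp add: scaleR_add_right scaleR_add_left)+
  show "dist A B = norm (A - B)" "sgn A = inverse (norm A) *\<^sub>R A"
    by (rule dist_cblinfun_def sgn_cblinfun_def)+
  show "(uniformity :: (('a, 'b) cblinfun \<times> ('a, 'b) cblinfun) filter)
      = (INF e\<in>{0<..}. principal {(A, B). dist A B < e})"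
    by (rule uniformity_cblinfun_def)
  show "open U = (\<forall>A\<in>U. \<forall>\<^sub>F (A', B) in uniformity. A' = A \<longrightarrow> B \<in> U)"
    for U :: "('a, 'b) cblinfun set"
    by (rule open_cblinfun_def)
  show "norm A = 0 \<longleftrightarrow> A = 0" "norm (A + B) \<le> norm A + norm B" "norm (r *\<^sub>R A) = \<bar>r\<bar> * norm A"
    by (transfer, simp add: norm_triangle_ineq)+
  show "c *\<^sub>C (A + B) = c *\<^sub>C A + c *\<^sub>C B" "(c + d) *\<^sub>C A = c *\<^sub>C A + d *\<^sub>C A"
    "c *\<^sub>C d *\<^sub>C A = (c * d) *\<^sub>C A" "of_real r *\<^sub>C A = r *\<^sub>R A"
    by (rule cblinfun_eqI, simp add: cblinfun_apply_ops scaleC_add_right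
        scaleC_add_left scaleC_scaleC scaleC_of_real)+
  show "norm (c *\<^sub>C A) = cmod c * norm A"
  proof (transfer, rule antisym)
    fix c and A :: "'a \<Rightarrow>\<^sub>L 'b"
    have le: "norm (Blinfun (\<lambda>x. c *\<^sub>C blinfun_apply A x)) \<le> cmod c * norm A"
      for c and A :: "'a \<Rightarrow>\<^sub>L 'b"
      by (rule norm_blinfun_bound)
        (auto simp: bounded_linear_Blinfun_apply bounded_linear_scaleC_blinfun norm_scaleC
          mult.assoc intro!: mult_left_mono norm_blinfun)
    show "norm (Blinfun (\<lambda>x. c *\<^sub>C blinfun_apply A x)) \<le> cmod c * norm A"
      by (rule le)
    show "cmod c * norm A \<le> norm (Blinfun (\<lambda>x. c *\<^sub>C blinfun_apply A x))"
    proof (cases "c = 0")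
      case False
      let ?B = "Blinfun (\<lambda>x. c *\<^sub>C blinfun_apply A x)"
      have "Blinfun (\<lambda>x. inverse c *\<^sub>C blinfun_apply ?B x) = A"
        using False scaleC_of_real[of 1]
        by (intro blinfun_eqI) (simp add: bounded_linear_Blinfun_apply
            bounded_linear_scaleC_blinfun scaleC_scaleC)
      with le[of "inverse c" ?B] have "norm A \<le> norm ?B / cmod c"
        by (simp add: norm_inverse divide_inverse mult.commute)
      with False show ?thesis
        by (simp add: field_simps)
    qed simp
  qed
qed

end

lemma bounded_linear_compose_right:
  "bounded_linear (\<lambda>B :: 'a::complex_normed_vector endo. A o\<^sub>C B)"
proof (rule bounded_linear_intro[where K = "norm A"])
  show "norm (A o\<^sub>C B) \<le> norm B * norm A" for B :: "'a endo"
    by (transfer, subst mult.commute, rule norm_blinfun_compose)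
qed (rule cblinfun_eqI, simp add: cblinfun_apply_compose cblinfun_apply_ops)+

lemma cblinfun_compose_scaleC_right: "A o\<^sub>C (c *\<^sub>C B) = c *\<^sub>C (A o\<^sub>C B)"
  by (rule cblinfun_eqI)
    (simp add: cblinfun_apply_compose cblinfun_apply_ops cblinfun_apply_scaleC)

lift_definition left_mult :: "'a::complex_normed_vector endo \<Rightarrow> 'a endo endo"
  is "\<lambda>A. Blinfun (\<lambda>B. A o\<^sub>C B)"
  by (simp add: bounded_linear_Blinfun_apply bounded_linear_compose_right
      cblinfun_compose_scaleC_right)

lemma cblinfun_apply_left_mult: "left_mult A \<cdot> B = A o\<^sub>C B"
  by (simp add: cblinfun_apply.rep_eq left_mult.rep_eq bounded_linear_Blinfun_apply
      bounded_linear_compose_right)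

section \<open>The Hardy space\<close>

definition taylor_coeff :: "(complex \<Rightarrow> complex) \<Rightarrow> nat \<Rightarrow> complex" where
  "taylor_coeff f n = (deriv ^^ n) f 0 / fact n"

lemma taylor_coeff_zero: "taylor_coeff (\<lambda>_. 0) n = 0"
  by (simp add: taylor_coeff_def)

lemma taylor_coeff_cong:
  assumes "f analytic_on ball 0 1" "\<And>z. z \<in> ball 0 1 \<Longrightarrow> f z = g z"
  shows "taylor_coeff f n = taylor_coeff g n"
proof -
  have f: "f holomorphic_on ball 0 1"
    using assms(1) by (simp add: analytic_on_open)
  then have "g holomorphic_on ball 0 1"
    using assms(2) by (rule holomorphic_transform)
  then show ?thesis
    using higher_deriv_transform_within_open[OF f, of g 0 n] assms(2)
    by (simp add: taylor_coeff_def)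
qed

lemma taylor_coeff_add:
  assumes "f analytic_on ball 0 1" "g analytic_on ball 0 1"
  shows "taylor_coeff (\<lambda>z. f z + g z) n = taylor_coeff f n + taylor_coeff g n"
  using assms higher_deriv_add[of f "ball 0 1" g 0 n]
  by (simp add: taylor_coeff_def analytic_on_open add_divide_distrib)

lemma taylor_coeff_cmult:
  assumes "f analytic_on ball 0 1"
  shows "taylor_coeff (\<lambda>z. c * f z) n = c * taylor_coeff f n"
  using assms higher_deriv_cmult[of f "ball 0 1" 0 n c]
  by (simp add: taylor_coeff_def analytic_on_open)

lemma taylor_sums:
  assumes "f analytic_on ball 0 1" "cmod z < 1"
  shows "(\<lambda>n. taylor_coeff f n * z ^ n) sums f z"
  using assms holomorphic_power_series[of f 0 1 z]
  by (simp add: taylor_coeff_def analytic_on_open)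

lemma summable_prod_of_squares:
  fixes a b :: "nat \<Rightarrow> complex"
  assumes "summable (\<lambda>n. (cmod (a n))\<^sup>2)" "summable (\<lambda>n. (cmod (b n))\<^sup>2)"
  shows "summable (\<lambda>n. cmod (a n) * cmod (b n))"
proof (rule summable_comparison_test'[OF summable_add[OF assms], of 0])
  fix n
  have "0 \<le> (cmod (a n) - cmod (b n))\<^sup>2" by simp
  then have "2 * (cmod (a n) * cmod (b n)) \<le> (cmod (a n))\<^sup>2 + (cmod (b n))\<^sup>2"
    by (simp add: power2_diff)
  moreover have "0 \<le> cmod (a n) * cmod (b n)" by simp
  ultimately show "norm (cmod (a n) * cmod (b n)) \<le> (cmod (a n))\<^sup>2 + (cmod (b n))\<^sup>2"
    unfolding real_norm_def by linarith
qed

lemma summable_add_squares: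
  fixes a b :: "nat \<Rightarrow> complex"
  assumes "summable (\<lambda>n. (cmod (a n))\<^sup>2)" "summable (\<lambda>n. (cmod (b n))\<^sup>2)"
  shows "summable (\<lambda>n. (cmod (a n + b n))\<^sup>2)"
proof (rule summable_comparison_test'[of "\<lambda>n. (cmod (a n))\<^sup>2 + (cmod (b n))\<^sup>2
    + 2 * (cmod (a n) * cmod (b n))" 0])
  show "summable (\<lambda>n. (cmod (a n))\<^sup>2 + (cmod (b n))\<^sup>2 + 2 * (cmod (a n) * cmod (b n)))"
    by (intro summable_add summable_mult assms summable_prod_of_squares)
  show "norm ((cmod (a n + b n))\<^sup>2)
      \<le> (cmod (a n))\<^sup>2 + (cmod (b n))\<^sup>2 + 2 * (cmod (a n) * cmod (b n))" for n
    using power_mono[OF norm_triangle_ineq[of "a n" "b n"] norm_ge_zero, of 2]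
    by (simp add: power2_sum)
qed

subsection \<open>Multiplication by a bounded analytic function\<close>

lemma has_integral_exp_int:
  fixes k :: int
  shows "((\<lambda>t. exp (\<i> * of_int k * of_real t)) has_integral (if k = 0 then of_real (2 * pi) else 0))
    {0..2 * pi}"
proof (cases "k = 0")
  case True
  then show ?thesis
    using has_integral_const_real[of "1::complex" 0 "2 * pi"] by (simp add: scaleR_conv_of_real)
next
  case False
  let ?F = "\<lambda>t::real. exp (\<i> * of_int k * of_real t) / (\<i> * of_int k)"
  have "((\<lambda>t. exp (\<i> * of_int k * of_real t)) has_integral (?F (2 * pi) - ?F 0)) {0..2 * pi}"
  proof (rule fundamental_theorem_of_calculus)
    fix t :: real
    have "((\<lambda>z. exp (\<i> * of_int k * z) / (\<i> * of_int k)) has_field_derivative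
        exp (\<i> * of_int k * of_real t)) (at (of_real t))"
      using False by (auto intro!: derivative_eq_intros)
    then show "(?F has_vector_derivative exp (\<i> * of_int k * of_real t)) (at t within {0..2 * pi})"
      by (rule has_vector_derivative_real_field)
  qed simp
  moreover have "exp (\<i> * of_int k * of_real (2 * pi)) = (1::complex)"
    using cis_multiple_2pi[of "of_int k"] by (simp add: cis_conv_exp mult_ac)
  ultimately show ?thesis
    using False by simp
qed

lemma has_integral_trig_poly:
  fixes c :: "nat \<Rightarrow> complex"
  shows "((\<lambda>t. (cmod (\<Sum>n<N. c n * exp (\<i> * of_real t) ^ n))\<^sup>2) has_integral
    2 * pi * (\<Sum>n<N. (cmod (c n))\<^sup>2)) {0..2 * pi}"
proof -
  let ?e = "\<lambda>n m t. c n * cnj (c m) * exp (\<i> * of_int (int n - int m) * of_real t)"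
  have cnj_e: "cnj (exp (\<i> * of_real t) ^ m) = exp (- (\<i> * of_nat m * of_real t))" for m and t :: real
    by (simp add: exp_cnj flip: exp_of_nat_mult) (simp add: mult_ac)
  have e: "of_real ((cmod (\<Sum>n<N. c n * exp (\<i> * of_real t) ^ n))\<^sup>2) = (\<Sum>n<N. \<Sum>m<N. ?e n m t)"
    for t :: real
  proof -
    have "exp (\<i> * of_real t) ^ n * exp (- (\<i> * of_nat m * of_real t))
        = exp (\<i> * of_int (int n - int m) * of_real t)" for n m
      by (simp flip: exp_of_nat_mult exp_add) (simp add: algebra_simps)
    then show ?thesis
      unfolding complex_norm_square cnj_sum sum_product complex_cnj_mult cnj_e
      by (intro sum.cong refl) (simp add: mult_ac)
  qed
  have "((\<lambda>t. \<Sum>n<N. \<Sum>m<N. ?e n m t) has_integral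
      (\<Sum>n<N. \<Sum>m<N. c n * cnj (c m) * (if int n - int m = 0 then of_real (2 * pi) else 0)))
      {0..2 * pi}"
    by (intro has_integral_sum finite_lessThan has_integral_mult_right has_integral_exp_int)
  also have "(\<Sum>n<N. \<Sum>m<N. c n * cnj (c m) * (if int n - int m = 0 then of_real (2 * pi) else 0))
      = (\<Sum>n<N. of_real (2 * pi) * (c n * cnj (c n)))"
    by (intro sum.cong refl) (simp add: if_distrib cong: if_cong)
  also have "\<dots> = of_real (2 * pi * (\<Sum>n<N. (cmod (c n))\<^sup>2))"
    by (simp add: sum_distrib_left complex_norm_square [symmetric])
  finally have "((\<lambda>t. of_real ((cmod (\<Sum>n<N. c n * exp (\<i> * of_real t) ^ n))\<^sup>2) :: complex)
      has_integral of_real (2 * pi * (\<Sum>n<N. (cmod (c n))\<^sup>2))) {0..2 * pi}"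
    by (simp only: e)
  from has_integral_Re[OF this] show ?thesis
    by simp
qed

lemma parseval_circle:
  assumes f: "f analytic_on ball 0 1" and r: "0 \<le> r" "r < 1"
  shows "(\<lambda>t. (cmod (f (of_real r * exp (\<i> * of_real t))))\<^sup>2) integrable_on {0..2 * pi}"
    and "(\<lambda>n. (cmod (taylor_coeff f n))\<^sup>2 * r ^ (2 * n)) sums
      (integral {0..2 * pi} (\<lambda>t. (cmod (f (of_real r * exp (\<i> * of_real t))))\<^sup>2) / (2 * pi))"
proof -
  let ?c = "\<lambda>n. taylor_coeff f n * of_real r ^ n"
  let ?P = "\<lambda>N t. (cmod (\<Sum>n<N. ?c n * exp (\<i> * of_real t) ^ n))\<^sup>2"
  let ?g = "\<lambda>t. (cmod (f (of_real r * exp (\<i> * of_real t))))\<^sup>2"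
  obtain s where s: "r < s" "s < 1" using r dense by blast
  have "summable (\<lambda>n. taylor_coeff f n * of_real s ^ n)"
    using taylor_sums[OF f, of "of_real s"] s r by (auto simp: sums_iff)
  then have sm: "summable (\<lambda>n. cmod (?c n))"
    using powser_insidea[of "taylor_coeff f" "of_real s" "of_real r"] s r by simp
  have bd: "norm (?P N t) \<le> (\<Sum>n. cmod (?c n))\<^sup>2" for N t
  proof -
    have "cmod (\<Sum>n<N. ?c n * exp (\<i> * of_real t) ^ n) \<le> (\<Sum>n<N. cmod (?c n))"
      by (rule order_trans[OF norm_sum]) (simp add: norm_mult norm_power)
    also have "\<dots> \<le> (\<Sum>n. cmod (?c n))"
      by (rule sum_le_suminf[OF sm]) auto
    finally have "(cmod (\<Sum>n<N. ?c n * exp (\<i> * of_real t) ^ n))\<^sup>2 \<le> (\<Sum>n. cmod (?c n))\<^sup>2"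
      by (rule power_mono) simp
    then show ?thesis by simp
  qed
  have lim: "(\<lambda>N. ?P N t) \<longlonglongrightarrow> ?g t" for t
  proof -
    have "(\<lambda>n. taylor_coeff f n * (of_real r * exp (\<i> * of_real t)) ^ n) sums
        f (of_real r * exp (\<i> * of_real t))"
      using r by (intro taylor_sums[OF f]) (simp add: norm_mult)
    then have "(\<lambda>N. \<Sum>n<N. ?c n * exp (\<i> * of_real t) ^ n) \<longlonglongrightarrow> f (of_real r * exp (\<i> * of_real t))"
      by (simp add: sums_def power_mult_distrib mult.assoc)
    then show ?thesis by (intro tendsto_intros)
  qed
  have int: "?P N integrable_on {0..2 * pi}" for N
    using has_integral_trig_poly[of ?c N] by (rule has_integral_integrable)
  have dc: "?g integrable_on {0..2 * pi}"
    "(\<lambda>N. integral {0..2 * pi} (?P N)) \<longlonglongrightarrow> integral {0..2 * pi} ?g"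
    using dominated_convergence[of ?P "{0..2 * pi}" "\<lambda>_. (\<Sum>n. cmod (?c n))\<^sup>2" ?g]
      int bd lim integrable_const_ivl by auto
  show "?g integrable_on {0..2 * pi}" by (fact dc(1))
  have "integral {0..2 * pi} (?P N) / (2 * pi) = (\<Sum>n<N. (cmod (taylor_coeff f n))\<^sup>2 * r ^ (2 * n))"
    for N
    using integral_unique[OF has_integral_trig_poly[of ?c N]] r
    by (simp add: norm_mult norm_power power_mult_distrib power_mult [symmetric] mult.commute)
  with tendsto_divide[OF dc(2) tendsto_const[of "2 * pi"]]
  show "(\<lambda>n. (cmod (taylor_coeff f n))\<^sup>2 * r ^ (2 * n)) sums (integral {0..2 * pi} ?g / (2 * pi))"
    by (simp add: sums_def)
qed

lemma mult_bounded_square_summable: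
  assumes f: "f analytic_on ball 0 1" and \<theta>: "\<theta> analytic_on ball 0 1"
    and M: "\<And>z. z \<in> ball 0 1 \<Longrightarrow> cmod (\<theta> z) \<le> M"
    and sm: "summable (\<lambda>n. (cmod (taylor_coeff f n))\<^sup>2)"
  shows "summable (\<lambda>n. (cmod (taylor_coeff (\<lambda>z. \<theta> z * f z) n))\<^sup>2)"
    and "(\<Sum>n. (cmod (taylor_coeff (\<lambda>z. \<theta> z * f z) n))\<^sup>2)
      \<le> M\<^sup>2 * (\<Sum>n. (cmod (taylor_coeff f n))\<^sup>2)"
proof -
  let ?h = "\<lambda>z. \<theta> z * f z"
  let ?a = "\<lambda>n. (cmod (taylor_coeff ?h n))\<^sup>2" and ?b = "\<lambda>n. (cmod (taylor_coeff f n))\<^sup>2"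
  have h: "?h analytic_on ball 0 1" using f \<theta> by (intro analytic_intros)
  have fin: "(\<Sum>n<N. ?a n * r ^ (2 * n)) \<le> M\<^sup>2 * (\<Sum>n. ?b n)" if r: "0 \<le> r" "r < 1" for r :: real and N
  proof -
    let ?z = "\<lambda>t::real. of_real r * exp (\<i> * of_real t) :: complex"
    have "(\<Sum>n<N. ?a n * r ^ (2 * n)) \<le> integral {0..2 * pi} (\<lambda>t. (cmod (?h (?z t)))\<^sup>2) / (2 * pi)"
      using sum_le_suminf[OF sums_summable[OF parseval_circle(2)[OF h r]], of "{..<N}"] r
        sums_unique[OF parseval_circle(2)[OF h r]] by simp
    also have "\<dots> \<le> integral {0..2 * pi} (\<lambda>t. M\<^sup>2 * (cmod (f (?z t)))\<^sup>2) / (2 * pi)"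
    proof (intro divide_right_mono integral_le parseval_circle(1)[OF h r])
      show "(\<lambda>t. M\<^sup>2 * (cmod (f (?z t)))\<^sup>2) integrable_on {0..2 * pi}"
        using integrable_on_cmult_left[OF parseval_circle(1)[OF f r], of "M\<^sup>2"] by simp
      show "(cmod (?h (?z t)))\<^sup>2 \<le> M\<^sup>2 * (cmod (f (?z t)))\<^sup>2" for t
        using M[of "?z t"] r
        by (simp add: norm_mult power_mult_distrib mult_right_mono power_mono)
    qed auto
    also have "\<dots> = M\<^sup>2 * (\<Sum>n. ?b n * r ^ (2 * n))"
      by (simp flip: sums_unique[OF parseval_circle(2)[OF f r]])
    also have "\<dots> \<le> M\<^sup>2 * (\<Sum>n. ?b n)"
    proof (intro mult_left_mono suminf_le sm sums_summable[OF parseval_circle(2)[OF f r]])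
      show "?b n * r ^ (2 * n) \<le> ?b n" for n
        using r by (simp add: mult_left_le power_le_one)
    qed simp
    finally show ?thesis .
  qed
  have part: "(\<Sum>n<N. ?a n) \<le> M\<^sup>2 * (\<Sum>n. ?b n)" for N
  proof (rule tendsto_upperbound)
    have "((\<lambda>r. \<Sum>n<N. ?a n * r ^ (2 * n)) \<longlongrightarrow> (\<Sum>n<N. ?a n * 1 ^ (2 * n))) (at_left (1::real))"
      by (intro tendsto_intros)
    then show "((\<lambda>r. \<Sum>n<N. ?a n * r ^ (2 * n)) \<longlongrightarrow> (\<Sum>n<N. ?a n)) (at_left (1::real))"
      by simp
    show "eventually (\<lambda>r. (\<Sum>n<N. ?a n * r ^ (2 * n)) \<le> M\<^sup>2 * (\<Sum>n. ?b n)) (at_left (1::real))"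
      using eventually_at_left_real[of 0 "1::real"] fin by (auto elim!: eventually_mono)
  qed simp
  show "summable ?a"
    by (rule summableI_nonneg_bounded[OF _ part]) simp
  then show "(\<Sum>n. ?a n) \<le> M\<^sup>2 * (\<Sum>n. ?b n)"
    using part by (intro suminf_le_const)
qed


subsection \<open>The space and its complex Hilbert structure\<close>

text \<open>
  Functions on the disc are represented by total functions vanishing off the disc, so that equality
  on the disc is equality in the type.
\<close>

typedef hardy2 =
  "{f :: complex \<Rightarrow> complex. f analytic_on ball 0 1 \<and> (\<forall>z. z \<notin> ball 0 1 \<longrightarrow> f z = 0) \<and>
      summable (\<lambda>n. (cmod (taylor_coeff f n))\<^sup>2)}"
  morphisms hfun Hardy2
  by (rule exI[of _ "\<lambda>_. 0"]) (simp add: taylor_coeff_zero)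

setup_lifting type_definition_hardy2

lemma hfun_analytic: "hfun f analytic_on ball 0 1"
  and hfun_off_disc: "\<not> cmod z < 1 \<Longrightarrow> hfun f z = 0"
  and hfun_square_summable: "summable (\<lambda>n. (cmod (taylor_coeff (hfun f) n))\<^sup>2)"
  by (transfer; simp)+

lemma hfun_eqI:
  assumes "\<And>n. taylor_coeff (hfun f) n = taylor_coeff (hfun g) n"
  shows "f = g"
proof -
  have "hfun f z = hfun g z" for z
  proof (cases "cmod z < 1")
    case True
    then show ?thesis
      using taylor_sums[OF hfun_analytic[of f] True] taylor_sums[OF hfun_analytic[of g] True] assms
      by (simp add: sums_unique2)
  qed (simp add: hfun_off_disc)
  then show ?thesis
    by (metis hfun_inject ext)
qed

text \<open>The inner product, linear in the first and conjugate-linear in the second argument.\<close>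

definition hinner :: "hardy2 \<Rightarrow> hardy2 \<Rightarrow> complex" where
  "hinner f g = (\<Sum>n. taylor_coeff (hfun f) n * cnj (taylor_coeff (hfun g) n))"

lemma hinner_summable: "summable (\<lambda>n. taylor_coeff (hfun f) n * cnj (taylor_coeff (hfun g) n))"
  by (rule summable_norm_cancel)
    (simp add: norm_mult summable_prod_of_squares hfun_square_summable)

instantiation hardy2 :: real_vector
begin

lift_definition zero_hardy2 :: hardy2 is "\<lambda>_. 0"
  by (simp add: taylor_coeff_zero)

lift_definition plus_hardy2 :: "hardy2 \<Rightarrow> hardy2 \<Rightarrow> hardy2" is "\<lambda>f g z. f z + g z"
  by (auto intro!: analytic_intros simp: taylor_coeff_add summable_add_squares)

lift_definition uminus_hardy2 :: "hardy2 \<Rightarrow> hardy2" is "\<lambda>f z. - f z"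
proof -
  fix f :: "complex \<Rightarrow> complex"
  assume "f analytic_on ball 0 1 \<and> (\<forall>z. z \<notin> ball 0 1 \<longrightarrow> f z = 0) \<and>
    summable (\<lambda>n. (cmod (taylor_coeff f n))\<^sup>2)"
  then show "(\<lambda>z. - f z) analytic_on ball 0 1 \<and> (\<forall>z. z \<notin> ball 0 1 \<longrightarrow> - f z = 0) \<and>
    summable (\<lambda>n. (cmod (taylor_coeff (\<lambda>z. - f z) n))\<^sup>2)"
    using taylor_coeff_cmult[of f "-1"] by (auto intro!: analytic_intros)
qed

definition minus_hardy2 :: "hardy2 \<Rightarrow> hardy2 \<Rightarrow> hardy2" where
  "minus_hardy2 f g = f + - g"

lift_definition scaleR_hardy2 :: "real \<Rightarrow> hardy2 \<Rightarrow> hardy2" is "\<lambda>r f z. of_real r * f z"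
  by (auto intro!: analytic_intros summable_mult
      simp: taylor_coeff_cmult norm_mult power_mult_distrib)

instance
  by standard
    ((unfold minus_hardy2_def)?, transfer, simp add: fun_eq_iff algebra_simps)+

end

instantiation hardy2 :: real_inner
begin

definition inner_hardy2 :: "hardy2 \<Rightarrow> hardy2 \<Rightarrow> real" where
  "inner_hardy2 f g = Re (hinner f g)"

definition norm_hardy2 :: "hardy2 \<Rightarrow> real" where
  "norm_hardy2 f = sqrt (Re (hinner f f))"

definition dist_hardy2 :: "hardy2 \<Rightarrow> hardy2 \<Rightarrow> real" where
  "dist_hardy2 f g = norm (f - g)"

definition sgn_hardy2 :: "hardy2 \<Rightarrow> hardy2" where
  "sgn_hardy2 f = f /\<^sub>R norm f"

definition uniformity_hardy2 :: "(hardy2 \<times> hardy2) filter" where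
  "uniformity_hardy2 = (INF e\<in>{0<..}. principal {(f, g). dist f g < e})"

definition open_hardy2 :: "hardy2 set \<Rightarrow> bool" where
  "open_hardy2 U = (\<forall>f\<in>U. \<forall>\<^sub>F (f', g) in uniformity. f' = f \<longrightarrow> g \<in> U)"

lemma hinner_self: "hinner f f = of_real (\<Sum>n. (cmod (taylor_coeff (hfun f) n))\<^sup>2)"
  by (simp add: hinner_def suminf_of_real hfun_square_summable flip: complex_norm_square)

lemma taylor_coeff_plus:
  "taylor_coeff (hfun (f + g)) n = taylor_coeff (hfun f) n + taylor_coeff (hfun g) n"
  by (simp add: plus_hardy2.rep_eq taylor_coeff_add hfun_analytic)

lemma taylor_coeff_scaleR:
  "taylor_coeff (hfun (r *\<^sub>R f)) n = of_real r * taylor_coeff (hfun f) n"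
  by (simp add: scaleR_hardy2.rep_eq taylor_coeff_cmult hfun_analytic)

instance
proof
  fix f g h :: hardy2 and r :: real
  show "dist f g = norm (f - g)" "sgn f = inverse (norm f) *\<^sub>R f"
    by (rule dist_hardy2_def sgn_hardy2_def)+
  show "(uniformity :: (hardy2 \<times> hardy2) filter) = (INF e\<in>{0<..}. principal {(f, g). dist f g < e})"
    by (rule uniformity_hardy2_def)
  show "open U = (\<forall>f\<in>U. \<forall>\<^sub>F (f', g) in uniformity. f' = f \<longrightarrow> g \<in> U)" for U :: "hardy2 set"
    by (rule open_hardy2_def)
  have "hinner g f = cnj (hinner f g)"
    unfolding hinner_def using sums_cnj[THEN iffD2, OF summable_sums[OF hinner_summable[of f g]]]
    by (simp add: sums_iff mult.commute)
  then show "inner f g = inner g f"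
    by (simp add: inner_hardy2_def)
  show "inner (f + g) h = inner f h + inner g h"
    using suminf_add[OF hinner_summable hinner_summable, of f h g h, symmetric]
    by (simp add: inner_hardy2_def hinner_def taylor_coeff_plus ring_distribs)
  show "inner (r *\<^sub>R f) g = r * inner f g"
    using suminf_mult[OF hinner_summable, of "of_real r" f g]
    by (simp add: inner_hardy2_def hinner_def taylor_coeff_scaleR mult.assoc)
  show "0 \<le> inner f f"
    by (simp add: inner_hardy2_def hinner_self suminf_nonneg hfun_square_summable)
  show "inner f f = 0 \<longleftrightarrow> f = 0"
  proof
    assume "inner f f = 0"
    then have "(cmod (taylor_coeff (hfun f) n))\<^sup>2 = 0" for n
      using suminf_eq_zero_iff[OF hfun_square_summable[of f]]
      by (simp add: inner_hardy2_def hinner_self)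
    then show "f = 0"
      by (intro hfun_eqI) (simp add: zero_hardy2.rep_eq taylor_coeff_zero)
  next
    assume "f = 0"
    then show "inner f f = 0"
      by (simp add: inner_hardy2_def hinner_def zero_hardy2.rep_eq taylor_coeff_zero)
  qed
  show "norm f = sqrt (inner f f)"
    by (simp add: norm_hardy2_def inner_hardy2_def)
qed

end

lemma norm_hardy2_eq: "norm f = sqrt (\<Sum>n. (cmod (taylor_coeff (hfun f) n))\<^sup>2)"
  by (simp add: norm_hardy2_def hinner_self)

instantiation hardy2 :: complex_normed_vector
begin

lift_definition scaleC_hardy2 :: "complex \<Rightarrow> hardy2 \<Rightarrow> hardy2" is "\<lambda>c f z. c * f z"
  by (auto intro!: analytic_intros summable_mult
      simp: taylor_coeff_cmult norm_mult power_mult_distrib)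

instance
proof
  fix f g :: hardy2 and c d :: complex and r :: real
  show "c *\<^sub>C (f + g) = c *\<^sub>C f + c *\<^sub>C g" "(c + d) *\<^sub>C f = c *\<^sub>C f + d *\<^sub>C f"
    "c *\<^sub>C d *\<^sub>C f = (c * d) *\<^sub>C f" "of_real r *\<^sub>C f = r *\<^sub>R f"
    by (transfer, simp add: fun_eq_iff algebra_simps)+
  show "norm (c *\<^sub>C f) = cmod c * norm f"
    using suminf_mult[OF hfun_square_summable, of "(cmod c)\<^sup>2" f]
    by (simp add: norm_hardy2_eq scaleC_hardy2.rep_eq taylor_coeff_cmult hfun_analytic norm_mult
        power_mult_distrib real_sqrt_mult)
qed

end

section \<open>Multiplication operators and the shift\<close>

text \<open>$H^\infty$, again with the value 0 off the disc.\<close>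

typedef hinf =
  "{\<theta> :: complex \<Rightarrow> complex. \<theta> analytic_on ball 0 1 \<and> (\<forall>z. z \<notin> ball 0 1 \<longrightarrow> \<theta> z = 0) \<and>
      bounded (\<theta> ` ball 0 1)}"
  morphisms inf_fun Hinf
  by (rule exI[of _ "\<lambda>_. 0"]) (auto simp: bounded_iff)

setup_lifting type_definition_hinf

lift_definition hardy_mult :: "hinf \<Rightarrow> hardy2 \<Rightarrow> hardy2" is "\<lambda>\<theta> f z. \<theta> z * f z"
  by (auto intro!: analytic_intros mult_bounded_square_summable(1) simp: bounded_iff)

lemma taylor_coeff_hardy_mult:
  "taylor_coeff (hfun (hardy_mult \<theta> f)) n = taylor_coeff (\<lambda>z. inf_fun \<theta> z * hfun f z) n"
  by (simp add: hardy_mult.rep_eq)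

lemma bounded_linear_hardy_mult: "bounded_linear (hardy_mult \<theta>)"
proof -
  obtain M where M: "\<And>z. z \<in> ball 0 1 \<Longrightarrow> cmod (inf_fun \<theta> z) \<le> M"
    using inf_fun[of \<theta>] unfolding mem_Collect_eq bounded_iff by blast
  have "0 \<le> M"
    using order_trans[OF norm_ge_zero M[of 0]] by simp
  have \<theta>: "inf_fun \<theta> analytic_on ball 0 1"
    using inf_fun[of \<theta>] by simp
  show ?thesis
  proof (rule bounded_linear_intro[where K = M])
    show "norm (hardy_mult \<theta> f) \<le> norm f * M" for f
    proof -
      have "norm (hardy_mult \<theta> f) \<le> sqrt (M\<^sup>2 * (\<Sum>n. (cmod (taylor_coeff (hfun f) n))\<^sup>2))"
        unfolding norm_hardy2_eq taylor_coeff_hardy_mult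
        by (intro real_sqrt_le_mono mult_bounded_square_summable(2) hfun_analytic \<theta> M
            hfun_square_summable)
      also have "\<dots> = norm f * M"
        using \<open>0 \<le> M\<close> by (simp add: norm_hardy2_eq real_sqrt_mult)
      finally show ?thesis .
    qed
  qed (transfer, simp add: fun_eq_iff algebra_simps)+
qed

lemma hardy_mult_scaleC: "hardy_mult \<theta> (c *\<^sub>C f) = c *\<^sub>C hardy_mult \<theta> f"
  by transfer (simp add: fun_eq_iff algebra_simps)

text \<open>
  $T_\theta$ is \<open>mult_op \<theta>\<close>, and $M_\theta$ is \<open>left_mult_op \<theta>\<close>.
\<close>

lift_definition mult_op :: "hinf \<Rightarrow> hardy2 endo" is "\<lambda>\<theta>. Blinfun (hardy_mult \<theta>)"
  by (simp add: bounded_linear_Blinfun_apply bounded_linear_hardy_mult hardy_mult_scaleC)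

lemma mult_op_apply: "hfun (mult_op \<theta> \<cdot> f) z = inf_fun \<theta> z * hfun f z"
  by (simp add: cblinfun_apply.rep_eq mult_op.rep_eq bounded_linear_Blinfun_apply
      bounded_linear_hardy_mult hardy_mult.rep_eq)

definition left_mult_op :: "hinf \<Rightarrow> hardy2 endo endo" where
  "left_mult_op \<theta> = left_mult (mult_op \<theta>)"

lift_definition hinf_id :: hinf is "\<lambda>z. if z \<in> ball 0 1 then z else 0"
proof -
  have "(\<lambda>z. if z \<in> ball 0 1 then z else 0) analytic_on ball (0::complex) 1"
    unfolding analytic_on_open[OF open_ball]
    by (rule holomorphic_transform[OF holomorphic_on_ident]) simp
  moreover have "bounded ((\<lambda>z. if z \<in> ball 0 1 then z else 0) ` ball (0::complex) 1)"
    by (auto simp: bounded_iff intro!: exI[of _ 1])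
  ultimately show ?thesis
    by simp
qed

definition shift :: "hardy2 endo" where
  "shift = mult_op hinf_id"

lemma shift_apply: "hfun (shift \<cdot> f) z = z * hfun f z"
  by (simp add: shift_def mult_op_apply hinf_id.rep_eq hfun_off_disc)

definition left_shift :: "hardy2 endo endo" where
  "left_shift = left_mult shift"

end

theory Submission
  imports Defs
begin

text \<open>
  Since \<open>X\<close> commutes with left multiplication by the shift \<open>S\<close>, it satisfies
  \<open>X (S\<^sup>n T) = S\<^sup>n X(T)\<close>. So everything rests on the classical description of the commutant of \<open>S\<close>:
  an operator \<open>A\<close> with \<open>S A = A S\<close> is multiplication by a bounded analytic function \<open>\<theta>\<close>, necessarily
  \<open>\<theta> = A 1\<close>. Applied to \<open>A = X(T)\<close> this gives \<open>S\<^sup>n X(T) = X(T) S\<^sup>n = T\<^sub>\<theta> S\<^sup>n\<close>.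

  That \<open>A\<close> acts as multiplication by \<open>\<theta>\<close> is algebraic, with no limit of polynomials involved. Each
  \<open>f\<close> in the Hardy space can be written \<open>f = f(0) 1 + S g\<close>, so the defect \<open>A f - \<theta> f\<close> equals \<open>z\<close> times
  the defect of \<open>g\<close>. Hence every defect is divisible by all powers of \<open>z\<close> and vanishes
  (lemma \<open>commutant_shift_apply\<close>).

  Boundedness of \<open>\<theta>\<close> comes from iterating \<open>A\<close>: as \<open>\<theta>\<^sup>n = A\<^sup>n 1\<close>, and evaluation at a point \<open>w\<close> is
  a bounded functional with some constant \<open>C\<^sub>w\<close>, one gets \<open>\<bar>\<theta>(w)\<bar>\<^sup>n \<le> C\<^sub>w \<parallel>A\<parallel>\<^sup>n\<close> for all \<open>n\<close>.
  Any value \<open>\<bar>\<theta>(w)\<bar> > \<parallel>A\<parallel>\<close> would violate this for large \<open>n\<close>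
  (lemma \<open>commutant_shift_symbol_bound\<close>).
\<close>

section \<open>Taylor coefficients and point evaluations\<close>

lemma taylor_coeff_0: "taylor_coeff f 0 = f 0"
  by (simp add: taylor_coeff_def)

lemma taylor_coeff_mult_ident:
  assumes "h analytic_on ball 0 1"
  shows "taylor_coeff (\<lambda>z. z * h z) (Suc n) = taylor_coeff h n"
proof -
  have "h analytic_on {0}"
    using assms by (rule analytic_on_subset) simp
  then obtain F where F: "h has_fps_expansion F"
    using analytic_at_imp_has_fps_expansion_0 by blast
  have "(\<lambda>z. z * h z) has_fps_expansion fps_X * F"
    by (intro fps_expansion_intros F)
  from fps_nth_fps_expansion[OF this, of "Suc n"] fps_nth_fps_expansion[OF F, of n]
  show ?thesis
    by (simp add: taylor_coeff_def)
qed

lemma norm_taylor_coeff_le: "cmod (taylor_coeff (hfun f) n) \<le> norm f"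
proof -
  have "(\<Sum>k\<in>{n}. (cmod (taylor_coeff (hfun f) k))\<^sup>2) \<le> (\<Sum>k. (cmod (taylor_coeff (hfun f) k))\<^sup>2)"
    by (rule sum_le_suminf) (auto simp: hfun_square_summable)
  then show ?thesis
    unfolding norm_hardy2_eq by (simp add: real_le_rsqrt)
qed

text \<open>
  Comparing the Taylor series with a geometric series is cruder than using the reproducing kernel,
  but any constant depending on \<open>z\<close> alone suffices below.
\<close>

lemma norm_hfun_le:
  assumes "cmod z < 1"
  shows "cmod (hfun f z) \<le> norm f / (1 - cmod z)"
proof -
  have geo: "(\<lambda>n. norm f * cmod z ^ n) sums (norm f * (1 / (1 - cmod z)))"
    using assms by (intro sums_mult geometric_sums) simp
  have le: "norm (taylor_coeff (hfun f) n * z ^ n) \<le> norm f * cmod z ^ n" for n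
    by (simp add: norm_mult norm_power mult_right_mono norm_taylor_coeff_le)
  have "cmod (hfun f z) = norm (\<Sum>n. taylor_coeff (hfun f) n * z ^ n)"
    by (rule arg_cong[OF sums_unique[OF taylor_sums[OF hfun_analytic assms]]])
  also have "\<dots> \<le> (\<Sum>n. norm f * cmod z ^ n)"
    by (rule norm_suminf_le[OF le sums_summable[OF geo]])
  also have "\<dots> = norm f * (1 / (1 - cmod z))"
    by (rule sums_unique[OF geo, symmetric])
  finally show ?thesis by simp
qed

lemma norm_cblinfun_apply_le: "norm (A \<cdot> x) \<le> norm A * norm x"
  by transfer (rule norm_blinfun)

section \<open>Splitting off the constant term\<close>

lift_definition hardy_one :: hardy2 is "\<lambda>z. if z \<in> ball 0 1 then 1 else 0"
proof -
  let ?u = "\<lambda>z::complex. if z \<in> ball 0 1 then 1 else 0 :: complex"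
  have an: "?u analytic_on ball 0 1"
    unfolding analytic_on_open[OF open_ball]
    by (rule holomorphic_transform[OF holomorphic_on_const]) simp
  have "taylor_coeff ?u n = (if n = 0 then 1 else 0)" for n
    using taylor_coeff_cong[OF an, of "\<lambda>_. 1" n]
    by (simp add: taylor_coeff_def)
  then have "(\<lambda>n. (cmod (taylor_coeff ?u n))\<^sup>2) = (\<lambda>n. if n = 0 then 1 else 0)"
    by auto
  then show "?u analytic_on ball 0 1 \<and> (\<forall>z. z \<notin> ball 0 1 \<longrightarrow> ?u z = 0) \<and>
      summable (\<lambda>n. (cmod (taylor_coeff ?u n))\<^sup>2)"
    using an by simp
qed

lemma hfun_hardy_one: "cmod z < 1 \<Longrightarrow> hfun hardy_one z = 1"
  by transfer simp

text \<open>
  The quotient \<open>(f - f(0)) / z\<close> has a removable singularity at the origin, and its coefficient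
  sequence is that of \<open>f\<close> moved down by one index, so it stays square-summable.
\<close>

lemma hardy_split_constant:
  obtains g where "f = hfun f 0 *\<^sub>C hardy_one + shift \<cdot> g"
proof -
  let ?F = "\<lambda>z. hfun f z - hfun f 0"
  define G where "G = (\<lambda>z. if z \<in> ball 0 1 then (if z = 0 then deriv ?F 0 else ?F z / z) else 0)"
  have holF: "?F holomorphic_on ball 0 1"
    using hfun_analytic[of f] by (auto simp: analytic_on_open intro!: holomorphic_intros)
  have "(\<lambda>z. if z = 0 then deriv ?F 0 else ?F z / z) holomorphic_on ball 0 1"
    using pole_lemma_open[OF holF open_ball, of 0] by (simp only: diff_self diff_zero)
  then have anG: "G analytic_on ball 0 1"
    unfolding analytic_on_open[OF open_ball] G_def
    by (rule holomorphic_transform) simp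
  have zG: "z * G z = ?F z" if "z \<in> ball 0 1" for z
    using that by (simp add: G_def)
  have coeff: "taylor_coeff G n = taylor_coeff (hfun f) (Suc n)" for n
  proof -
    have "taylor_coeff G n = taylor_coeff (\<lambda>z. z * G z) (Suc n)"
      by (simp add: taylor_coeff_mult_ident[OF anG])
    also have "\<dots> = taylor_coeff ?F (Suc n)"
      by (rule taylor_coeff_cong) (auto simp: zG intro!: analytic_intros anG)
    also have "\<dots> = taylor_coeff (hfun f) (Suc n) + taylor_coeff (\<lambda>_. - hfun f 0) (Suc n)"
      using taylor_coeff_add[OF hfun_analytic[of f], of "\<lambda>_. - hfun f 0" "Suc n"]
      by simp
    also have "taylor_coeff (\<lambda>_. - hfun f 0) (Suc n) = 0"
      by (simp add: taylor_coeff_def del: funpow.simps)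
    finally show ?thesis by simp
  qed
  have "summable (\<lambda>n. (cmod (taylor_coeff G n))\<^sup>2)"
    using hfun_square_summable[of f] unfolding coeff by (subst summable_Suc_iff)
  then have hG: "hfun (Hardy2 G) = G"
    using anG by (intro Hardy2_inverse) (simp add: G_def)
  have "hfun f z = hfun (hfun f 0 *\<^sub>C hardy_one + shift \<cdot> Hardy2 G) z" for z
  proof (cases "cmod z < 1")
    case True
    then show ?thesis
      using zG[of z]
      by (simp add: plus_hardy2.rep_eq scaleC_hardy2.rep_eq shift_apply hG hfun_hardy_one)
  qed (simp add: hfun_off_disc)
  then have "f = hfun f 0 *\<^sub>C hardy_one + shift \<cdot> Hardy2 G"
    by (intro hfun_inject[THEN iffD1] ext)
  then show thesis ..
qed

section \<open>The commutant of the shift\<close>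

lemma commutantD: "B \<in> commutant A \<Longrightarrow> A \<cdot> (B \<cdot> x) = B \<cdot> (A \<cdot> x)"
  unfolding commutant_def mem_Collect_eq by (metis cblinfun_apply_compose)

text \<open>
  The defect \<open>D f = A f - (A 1) f\<close> is linear in \<open>f\<close>, vanishes for \<open>f = 1\<close>, and satisfies
  \<open>D (S g) = z D g\<close> because \<open>A\<close> commutes with \<open>S\<close>. Splitting off the constant term of \<open>f\<close> thus gives
  \<open>D f = z D g\<close>, where \<open>D g\<close> is again a defect. Repeating this, one Taylor coefficient of \<open>D f\<close> is
  seen to vanish at each step.
\<close>

lemma commutant_shift_apply:
  assumes A: "A \<in> commutant shift"
  shows "hfun (A \<cdot> f) z = hfun (A \<cdot> hardy_one) z * hfun f z"
proof (cases "cmod z < 1")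
  case True
  define D where "D = (\<lambda>f z. hfun (A \<cdot> f) z - hfun (A \<cdot> hardy_one) z * hfun f z)"
  have an: "D f analytic_on ball 0 1" for f
    unfolding D_def by (intro analytic_intros hfun_analytic)
  have step: "\<exists>g. \<forall>z\<in>ball 0 1. D f z = z * D g z" for f
  proof -
    obtain g where g: "f = hfun f 0 *\<^sub>C hardy_one + shift \<cdot> g"
      by (rule hardy_split_constant)
    have Af: "A \<cdot> f = hfun f 0 *\<^sub>C (A \<cdot> hardy_one) + shift \<cdot> (A \<cdot> g)"
      by (subst g) (simp add: cblinfun_apply_ops cblinfun_apply_scaleC commutantD[OF A])
    have "D f z = z * D g z" if "z \<in> ball 0 1" for z
    proof -
      have fz: "hfun f z = hfun f 0 + z * hfun g z"
        using that
        by (subst g) (simp add: plus_hardy2.rep_eq scaleC_hardy2.rep_eq shift_apply hfun_hardy_one)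
      show ?thesis
        unfolding D_def Af fz
        by (simp add: plus_hardy2.rep_eq scaleC_hardy2.rep_eq shift_apply algebra_simps)
    qed
    then show ?thesis by blast
  qed
  have coeff: "taylor_coeff (D f) n = 0" for f n
  proof (induction n arbitrary: f)
    case 0
    obtain g where "\<forall>z\<in>ball 0 1. D f z = z * D g z"
      using step by blast
    then have "D f 0 = 0 * D g 0"
      by (rule bspec) simp
    then show ?case
      by (simp add: taylor_coeff_0)
  next
    case (Suc n)
    obtain g where g: "\<forall>z\<in>ball 0 1. D f z = z * D g z"
      using step by blast
    then have "taylor_coeff (D f) (Suc n) = taylor_coeff (\<lambda>z. z * D g z) (Suc n)"
      by (intro taylor_coeff_cong an) auto
    with Suc show ?case
      by (simp add: taylor_coeff_mult_ident[OF an])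
  qed
  have "D f z = 0"
    using taylor_sums[OF an True, of f] by (simp add: coeff sums_iff)
  then show ?thesis
    by (simp add: D_def)
qed (simp add: hfun_off_disc)

text \<open>
  A direct estimate of \<open>\<theta> = A 1\<close> at \<open>w\<close> gives only \<open>\<parallel>A\<parallel> C\<^sub>w\<close>, which blows up at the unit circle.
  Applying it to \<open>\<theta>\<^sup>n = A\<^sup>n 1\<close> and letting \<open>n\<close> grow removes the factor \<open>C\<^sub>w\<close>, since it enters only
  through its \<open>n\<close>-th root.
\<close>

lemma commutant_shift_symbol_bound:
  assumes A: "A \<in> commutant shift" and w: "cmod w < 1"
  shows "cmod (hfun (A \<cdot> hardy_one) w) \<le> norm A"
proof (rule ccontr)
  let ?t = "cmod (hfun (A \<cdot> hardy_one) w)"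
  let ?C = "norm hardy_one / (1 - cmod w)"
  assume "\<not> ?t \<le> norm A"
  then have less: "norm A < ?t" by simp
  have eval: "hfun (((\<lambda>f. A \<cdot> f) ^^ n) hardy_one) w = hfun (A \<cdot> hardy_one) w ^ n" for n
  proof (induction n)
    case (Suc n)
    then show ?case
      using commutant_shift_apply[OF A, of "((\<lambda>f. A \<cdot> f) ^^ n) hardy_one" w] by simp
  qed (simp add: hfun_hardy_one w)
  have norm_pow: "norm (((\<lambda>f. A \<cdot> f) ^^ n) hardy_one) \<le> norm A ^ n * norm hardy_one" for n
  proof (induction n)
    case (Suc n)
    then show ?case
      using order_trans[OF norm_cblinfun_apply_le mult_left_mono[OF Suc norm_ge_zero[of A]]]
      by (simp add: mult.assoc)
  qed simp
  have pow: "?t ^ n \<le> norm A ^ n * ?C" for n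
  proof -
    have "?t ^ n \<le> norm (((\<lambda>f. A \<cdot> f) ^^ n) hardy_one) / (1 - cmod w)"
      using norm_hfun_le[OF w, of "((\<lambda>f. A \<cdot> f) ^^ n) hardy_one"] by (simp add: eval norm_power)
    also have "\<dots> \<le> norm A ^ n * norm hardy_one / (1 - cmod w)"
      using w by (intro divide_right_mono norm_pow) simp
    finally show ?thesis by simp
  qed
  have "0 < ?t"
    using less norm_ge_zero[of A] by linarith
  then have "(\<lambda>n. (norm A / ?t) ^ n * ?C) \<longlonglongrightarrow> 0 * ?C"
    using less by (intro tendsto_mult LIMSEQ_realpow_zero tendsto_const) simp_all
  moreover have "1 \<le> (norm A / ?t) ^ n * ?C" for n
    proof -
    have "0 < ?t ^ n"
      using \<open>0 < ?t\<close> by (rule zero_less_power)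
    then have "1 \<le> norm A ^ n * ?C / ?t ^ n"
      using pow[of n] by (simp only: le_divide_eq_1_pos)
    then show ?thesis
      by (simp only: power_divide times_divide_eq_left)
  qed
  ultimately have "(1::real) \<le> 0 * ?C"
    by (intro tendsto_lowerbound[where F = sequentially]) auto
  then show False by simp
qed

lemma commutant_shift_is_mult_op:
  assumes A: "A \<in> commutant shift"
  obtains \<theta> where "A = mult_op \<theta>"
proof -
  let ?u = "hfun (A \<cdot> hardy_one)"
  have "bounded (?u ` ball 0 1)"
    unfolding bounded_iff using commutant_shift_symbol_bound[OF A] by (intro exI[of _ "norm A"]) auto
  then have u: "inf_fun (Hinf ?u) = ?u"
    using hfun_analytic by (intro Hinf_inverse) (auto simp: hfun_off_disc)
  have "hfun (A \<cdot> f) = hfun (mult_op (Hinf ?u) \<cdot> f)" for f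
    by (rule ext, unfold mult_op_apply u, rule commutant_shift_apply[OF A])
  then have "A \<cdot> f = mult_op (Hinf ?u) \<cdot> f" for f
    by (rule hfun_inject[THEN iffD1])
  then have "A = mult_op (Hinf ?u)"
    by (rule cblinfun_eqI)
  then show thesis ..
qed

section \<open>Operators commuting with left multiplication by the shift\<close>

lemma commutant_power:
  assumes "B \<in> commutant A"
  shows "cblinfun_power A n o\<^sub>C B = B o\<^sub>C cblinfun_power A n"
proof (rule cblinfun_eqI)
  show "(cblinfun_power A n o\<^sub>C B) \<cdot> x = (B o\<^sub>C cblinfun_power A n) \<cdot> x" for x
    by (induction n)
      (simp_all add: cblinfun_apply_compose cblinfun_apply.rep_eq[of cblinfun_id]
        cblinfun_id.rep_eq commutantD[OF assms])
qed

lemma commutant_left_mult_power: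
  assumes "X \<in> commutant (left_mult A)"
  shows "X \<cdot> (cblinfun_power A n o\<^sub>C T) = cblinfun_power A n o\<^sub>C (X \<cdot> T)"
proof (induction n)
  case 0
  have "cblinfun_id o\<^sub>C B = B" for B :: "'a endo"
    by (rule cblinfun_eqI)
      (simp add: cblinfun_apply_compose cblinfun_apply.rep_eq[of cblinfun_id] cblinfun_id.rep_eq)
  then show ?case by simp
next
  case (Suc n)
  have assoc: "(A o\<^sub>C B) o\<^sub>C C = A o\<^sub>C (B o\<^sub>C C)" for B C :: "'a endo"
    by (rule cblinfun_eqI) (simp add: cblinfun_apply_compose)
  show ?case
    using commutantD[OF assms, of "cblinfun_power A n o\<^sub>C T"]
    by (simp add: assoc Suc cblinfun_apply_left_mult)
qed

theorem corollary2p9: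
  fixes T :: "hardy2 endo"
  shows "\<forall>X :: hardy2 endo endo.
    X \<in> commutant left_shift \<and> X \<cdot> T \<in> commutant shift \<longrightarrow>
      (\<exists>\<theta>' :: hinf. \<forall>n :: nat.
        X \<cdot> (cblinfun_power shift n o\<^sub>C T) = left_mult_op \<theta>' \<cdot> cblinfun_power shift n)"
proof (intro allI impI, elim conjE)
  fix X :: "hardy2 endo endo"
  assume X: "X \<in> commutant left_shift" and XT: "X \<cdot> T \<in> commutant shift"
  obtain \<theta> where \<theta>: "X \<cdot> T = mult_op \<theta>"
    by (rule commutant_shift_is_mult_op[OF XT])
  have "X \<cdot> (cblinfun_power shift n o\<^sub>C T) = left_mult_op \<theta> \<cdot> cblinfun_power shift n" for n
    using commutant_left_mult_power[OF X[unfolded left_shift_def], of n T] commutant_power[OF XT, of n]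
    by (simp add: \<theta> left_mult_op_def cblinfun_apply_left_mult)
  then show "\<exists>\<theta>'. \<forall>n. X \<cdot> (cblinfun_power shift n o\<^sub>C T) = left_mult_op \<theta>' \<cdot> cblinfun_power shift n"
    by blast
qed

end
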